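(* Let $\lambda=(1^{a_1},2^{a_2},\ldots,n^{a_n})\vdash n$, $n\ge 2$. Then \[\mathbb{E}_\lambda[\operatorname{cdes}]=\frac{n}{2}+\frac{a_2-\binom{a_1}{2}}{n-1} +\frac{a_1-1}{n-1},\] and hence the expected value of cyclic descents is independent of the conjugacy class if $a_1=a_2=0$.
   Context: The cyclic descent set of $\omega\in S_n$ is $\{1\le i\le n: \omega(i)>\omega(i+1)\}$ with the convention $\omega(n+1):=\omega(1)$, and $\operatorname{cdes}(\omega)$ is its cardinality. The partition $\lambda$ has $a_i$ parts equal to $i$; $\mathbb{E}_\lambda$ denotes expectation under the uniform measure on the conjugacy class $C_\lambda$ of $S_n$ of cycle type $\lambda$. *)

theory Defs
  imports
    "HOL-Probability.Probability"
    "HOL-Combinatorics.Permutations"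
    "HOL-Combinatorics.Orbits"
    "HOL-Library.Multiset"
begin

text \<open>
  The elements of \<open>S\<^sub>n\<close> are the functions \<open>w :: nat \<Rightarrow> nat\<close> with \<open>w permutes {1..n}\<close>.
  A partition \<open>(1\<^bsup>a\<^sub>1\<^esup>, 2\<^bsup>a\<^sub>2\<^esup>, \<dots>)\<close> is the multiset of its (positive) parts, so that
  \<open>a\<^sub>i = count lam i\<close>.
\<close>

definition is_partition :: "nat multiset \<Rightarrow> nat \<Rightarrow> bool" where
  "is_partition lam n \<longleftrightarrow> 0 \<notin># lam \<and> sum_mset lam = n"

text \<open>
  \<open>orbit w ` {1..n}\<close> is a set, so each cycle of \<open>w\<close> (fixed points included) contributes
  its length exactly once.
\<close>

definition cycle_type :: "nat \<Rightarrow> (nat \<Rightarrow> nat) \<Rightarrow> nat multiset" where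
  "cycle_type n w = image_mset card (mset_set (orbit w ` {1..n}))"

definition conj_class :: "nat \<Rightarrow> nat multiset \<Rightarrow> (nat \<Rightarrow> nat) set" where
  "conj_class n lam = {w. w permutes {1..n} \<and> cycle_type n w = lam}"

text \<open>The \<open>if\<close> encodes the convention \<open>w(n + 1) := w(1)\<close>.\<close>

definition cyclic_descent_set :: "nat \<Rightarrow> (nat \<Rightarrow> nat) \<Rightarrow> nat set" where
  "cyclic_descent_set n w = {i \<in> {1..n}. w i > (if i = n then w 1 else w (i + 1))}"

definition cdes :: "nat \<Rightarrow> (nat \<Rightarrow> nat) \<Rightarrow> nat" where
  "cdes n w = card (cyclic_descent_set n w)"

definition class_expectation ::
    "nat \<Rightarrow> nat multiset \<Rightarrow> ((nat \<Rightarrow> nat) \<Rightarrow> real) \<Rightarrow> real" where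
  "class_expectation n lam X = measure_pmf.expectation (pmf_of_set (conj_class n lam)) X"

end

theory Submission
  imports Defs
begin

text \<open>
  The uniform measure on a conjugacy class is invariant under conjugation. Conjugating by the
  transposition of \<open>i\<close> and \<open>i + 1\<close> shows that
  \<open>2 P(w(i) > w(i + 1)) = 1 + P(w swaps i and i + 1) - P(w fixes i and i + 1)\<close>. Conjugating by
  the cyclic shift compares the wrap-around descent with the descent at \<open>1\<close>:
  \<open>P(w(n) > w(1)) = P(w(1) > w(2)) + P(w(n) = n) - P(w(1) = n)\<close>. Each probability on the right
  of the resulting formula does not depend on the chosen points, so averaging over all ordered
  pairs of distinct points expresses it through \<open>a\<^sub>1\<close> and \<open>a\<^sub>2\<close>.
\<close>

section \<open>Conjugation\<close>

lemma orbit_conj: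
  assumes "bij s" and "permutation w"
  shows "orbit (s \<circ> w \<circ> inv s) (s x) = s ` orbit w x"
proof -
  have "s ` orbit w x = orbit (s \<circ> w \<circ> inv s) (s x)"
    by (rule orbit_inverse)
       (use assms in \<open>auto simp: permutation_self_in_orbit bij_is_inj\<close>)
  then show ?thesis by simp
qed

text \<open>The cycles of the conjugate are the images under \<open>s\<close> of the cycles of
  \<open>w\<close>, and an injective \<open>s\<close> preserves their lengths.\<close>

lemma cycle_type_conj:
  assumes s: "s permutes {1..n}" and w: "w permutes {1..n}"
  shows "cycle_type n (s \<circ> w \<circ> inv s) = cycle_type n w"
proof -
  have perm: "permutation w" using w permutation_permutes by blast
  have inj: "inj s" using s by (rule permutes_inj)
  have "orbit (s \<circ> w \<circ> inv s) ` {1..n} = orbit (s \<circ> w \<circ> inv s) ` s ` {1..n}"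
    unfolding permutes_image[OF s] ..
  also have "\<dots> = (\<lambda>X. s ` X) ` orbit w ` {1..n}"
    using orbit_conj[OF permutes_bij[OF s] perm] by (simp add: image_image)
  finally have "mset_set (orbit (s \<circ> w \<circ> inv s) ` {1..n}) =
      image_mset (\<lambda>X. s ` X) (mset_set (orbit w ` {1..n}))"
    using inj by (simp add: image_mset_mset_set inj_on_def inj_image_eq_iff)
  then show ?thesis
    unfolding cycle_type_def
    by (simp add: multiset.map_comp comp_def card_image inj_on_subset[OF inj])
qed

lemma finite_conj_class: "finite (conj_class n lam)"
  by (rule finite_subset[OF _ finite_permutations[of "{1..n}"]]) (auto simp: conj_class_def)

lemma conj_class_conj:
  assumes "s permutes {1..n}" and "w \<in> conj_class n lam"
  shows "s \<circ> w \<circ> inv s \<in> conj_class n lam"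
  using assms cycle_type_conj[of s n w]
  by (auto simp: conj_class_def intro!: permutes_compose permutes_inv)

text \<open>Conjugation by \<open>s\<close> is a bijection of the class onto itself, with
  conjugation by \<open>inv s\<close> as its inverse. This is the invariance of the uniform measure,
  for an arbitrary event \<open>P\<close>.\<close>

lemma card_conj_class_conj:
  assumes s: "s permutes {1..n}"
  shows "card {w \<in> conj_class n lam. P (s \<circ> w \<circ> inv s)} = card {w \<in> conj_class n lam. P w}"
proof (rule bij_betw_same_card)
  have inv: "s \<circ> (inv s \<circ> w \<circ> s) \<circ> inv s = w" "inv s \<circ> (s \<circ> w \<circ> inv s) \<circ> s = w" for w
    using permutes_inverses[OF s] by (auto simp: fun_eq_iff)
  have "inv s \<circ> w \<circ> s \<in> conj_class n lam" if "w \<in> conj_class n lam" for w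
    using conj_class_conj[OF permutes_inv[OF s] that] permutes_inv_inv[OF s] by simp
  then show "bij_betw (\<lambda>w. s \<circ> w \<circ> inv s)
      {w \<in> conj_class n lam. P (s \<circ> w \<circ> inv s)} {w \<in> conj_class n lam. P w}"
    by (intro bij_betw_byWitness[where f' = "\<lambda>w. inv s \<circ> w \<circ> s"])
       (auto simp: inv intro: conj_class_conj[OF s])
qed

section \<open>Double counting over ordered pairs of distinct points\<close>

lemma exists_permutes_pair:
  assumes "i \<in> S" "j \<in> S" "p \<in> S" "q \<in> S" "i \<noteq> j" "p \<noteq> q"
  shows "\<exists>s. s permutes S \<and> s i = p \<and> s j = q"
proof -
  \<comment> \<open>\<open>k\<close> is where \<open>j\<close> lands once \<open>i\<close> has been
    moved to \<open>p\<close>. The second transposition exchanges \<open>k\<close> and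
    \<open>q\<close>, both different from \<open>p\<close>, so it leaves \<open>p\<close> in
    place.\<close>
  define k where "k = Transposition.transpose i p j"
  have "k \<in> S" "k \<noteq> p" using assms by (auto simp: k_def Transposition.transpose_def)
  then have "(Transposition.transpose k q \<circ> Transposition.transpose i p) permutes S"
    using assms by (intro permutes_compose permutes_swap_id)
  moreover have "(Transposition.transpose k q \<circ> Transposition.transpose i p) i = p"
    using \<open>k \<noteq> p\<close> \<open>p \<noteq> q\<close> by simp
  moreover have "(Transposition.transpose k q \<circ> Transposition.transpose i p) j = q"
    by (simp add: k_def[symmetric])
  ultimately show ?thesis by blast
qed

lemma card_offdiagonal:
  fixes n :: nat
  shows "card {(p, q). p \<in> {1..n} \<and> q \<in> {1..n} \<and> p \<noteq> q} = n * (n - 1)"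
proof -
  have "{(p, q). p \<in> {1..n} \<and> q \<in> {1..n} \<and> p \<noteq> q} = Sigma {1..n} (\<lambda>p. {1..n} - {p})"
    by auto
  then show ?thesis by simp
qed

text \<open>Double counting of triples \<open>(w, p, q)\<close>. A relation that respects
  simultaneous relabelling is satisfied by equally many \<open>w\<close> at every ordered pair,
  since the symmetric group is 2-transitive and the class is closed under conjugation.\<close>

lemma sum_card_equivariant:
  assumes equiv: "\<And>s w p q. s permutes {1..n} \<Longrightarrow> R (s \<circ> w \<circ> inv s) (s p) (s q) \<longleftrightarrow> R w p q"
    and ij: "i \<in> {1..n}" "j \<in> {1..n}" "i \<noteq> j"
  shows "(\<Sum>w\<in>conj_class n lam. card {(p, q). p \<in> {1..n} \<and> q \<in> {1..n} \<and> p \<noteq> q \<and> R w p q}) =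
    n * (n - 1) * card {w \<in> conj_class n lam. R w i j}"
proof -
  let ?T = "{(p, q). p \<in> {1..n} \<and> q \<in> {1..n} \<and> p \<noteq> q}"
  have "(\<Sum>w\<in>conj_class n lam. card {x\<in>?T. case x of (p, q) \<Rightarrow> R w p q}) =
      card {w \<in> conj_class n lam. R w i j} * card ?T"
  proof (rule sum_multicount)
    show "finite ?T"
      by (rule finite_subset[of _ "{1..n} \<times> {1..n}"]) auto
    show "\<forall>x\<in>?T. card {w \<in> conj_class n lam. case x of (p, q) \<Rightarrow> R w p q} =
        card {w \<in> conj_class n lam. R w i j}"
    proof clarify
      fix p q assume "p \<in> {1..n}" "q \<in> {1..n}" "p \<noteq> q"
      with ij obtain s where s: "s permutes {1..n}" and "s i = p" "s j = q"
        using exists_permutes_pair[of i "{1..n}" j p q] by blast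
      with equiv[OF s, of _ i j] card_conj_class_conj[OF s, of lam "\<lambda>w. R w p q"]
      show "card {w \<in> conj_class n lam. R w p q} = card {w \<in> conj_class n lam. R w i j}"
        by simp
    qed
  qed (rule finite_conj_class)
  moreover have "{x\<in>?T. case x of (p, q) \<Rightarrow> R w p q} =
      {(p, q). p \<in> {1..n} \<and> q \<in> {1..n} \<and> p \<noteq> q \<and> R w p q}" for w
    by auto
  ultimately show ?thesis by (simp only: card_offdiagonal mult.commute)
qed

section \<open>Short cycles\<close>

lemma card_orbit_eq_1_iff:
  assumes "permutation w"
  shows "card (orbit w x) = 1 \<longleftrightarrow> w x = x"
  using permutation_self_in_orbit[OF assms, of x] orbit_eq_singleton_iff[of w x]
  by (auto simp: card_1_singleton_iff)

lemma card_orbit_eq_2_iff: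
  assumes "permutation w"
  shows "card (orbit w x) = 2 \<longleftrightarrow> w x \<noteq> x \<and> w (w x) = x"
proof
  assume c: "card (orbit w x) = 2"
  have x: "x \<in> orbit w x" using assms by (rule permutation_self_in_orbit)
  have wx: "w x \<in> orbit w x" and wwx: "w (w x) \<in> orbit w x" by (auto intro: orbit.intros)
  have ne: "w x \<noteq> x" using c card_orbit_eq_1_iff[OF assms, of x] by auto
  have "finite (orbit w x)" using c by (intro card_ge_0_finite) simp
  then have "orbit w x = {x, w x}"
    using c x wx ne by (intro card_subset_eq[symmetric]) auto
  moreover have "w (w x) \<noteq> w x"
    using ne assms permutation_bijective[of w] by (auto simp: bij_def inj_eq)
  ultimately show "w x \<noteq> x \<and> w (w x) = x" using ne wwx by auto
next
  assume h: "w x \<noteq> x \<and> w (w x) = x"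
  then have "orbit w x = {(w ^^ m) x |m. m < 2}"
    by (intro orbit_altdef_bounded) (simp_all add: numeral_2_eq_2)
  also have "\<dots> = {x, w x}"
    by (auto simp: less_2_cases_iff intro: exI[of _ 0] exI[of _ "1::nat"])
  finally show "card (orbit w x) = 2" using h by (simp add: eq_commute)
qed

lemma count_image_mset_set:
  assumes "finite A"
  shows "count (image_mset f (mset_set A)) k = card {x \<in> A. f x = k}"
  using assms by (simp add: count_image_mset' eq_commute)

text \<open>The points lying on cycles of length \<open>k\<close> are partitioned by those cycles
  into blocks of size \<open>k\<close>. The cases 1 and 2 link the multiplicities in the partition
  to pointwise conditions on \<open>w\<close>.\<close>

lemma card_orbit_eq_count_cycle_type:
  assumes w: "w permutes {1..n}"
  shows "card {i \<in> {1..n}. card (orbit w i) = k} = k * count (cycle_type n w) k"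
proof -
  have perm: "permutation w" using w permutation_permutes by blast
  let ?X = "{X \<in> orbit w ` {1..n}. card X = k}"
  have un: "\<Union>?X = {i \<in> {1..n}. card (orbit w i) = k}"
  proof (intro equalityI subsetI)
    fix i assume "i \<in> \<Union>?X"
    then obtain j where j: "j \<in> {1..n}" "card (orbit w j) = k" "i \<in> orbit w j" by auto
    have "orbit w i = orbit w j"
      using cyclic_on_orbit'[OF perm] j(3) by (rule orbit_cyclic_eq3)
    with j permutes_orbit_subset[OF w j(1)] show "i \<in> {i \<in> {1..n}. card (orbit w i) = k}"
      by auto
  qed (use permutation_self_in_orbit[OF perm] in auto)
  have "k * card ?X = card (\<Union>?X)"
  proof (rule card_partition)
    show "c1 \<inter> c2 = {}" if "c1 \<in> ?X" "c2 \<in> ?X" "c1 \<noteq> c2" for c1 c2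
      using that orbit_cyclic_eq3[OF cyclic_on_orbit'[OF perm]] by (auto; metis)
    show "finite (\<Union>?X)" unfolding un by simp
  qed auto
  then show ?thesis
    unfolding un cycle_type_def by (subst count_image_mset_set) simp_all
qed

lemma card_fixpoints:
  assumes "w \<in> conj_class n lam"
  shows "card {i \<in> {1..n}. w i = i} = count lam 1"
proof -
  have w: "w permutes {1..n}" and lam: "cycle_type n w = lam"
    using assms by (auto simp: conj_class_def)
  have "permutation w" using w permutation_permutes by blast
  then show ?thesis
    using card_orbit_eq_count_cycle_type[OF w, of 1] lam by (simp only: card_orbit_eq_1_iff mult_1)
qed

lemma card_two_cycle_points:
  assumes "w \<in> conj_class n lam"
  shows "card {i \<in> {1..n}. w i \<noteq> i \<and> w (w i) = i} = 2 * count lam 2"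
proof -
  have w: "w permutes {1..n}" and lam: "cycle_type n w = lam"
    using assms by (auto simp: conj_class_def)
  have "permutation w" using w permutation_permutes by blast
  then show ?thesis
    using card_orbit_eq_count_cycle_type[OF w, of 2] lam by (simp add: card_orbit_eq_2_iff)
qed


section \<open>Incidence counts for one or two points\<close>

lemma card_offdiagonal_of_conj_class:
  assumes "w \<in> conj_class n lam"
  shows "card {(p, q). p \<in> {1..n} \<and> q \<in> {1..n} \<and> p \<noteq> q \<and> w p = p} = count lam 1 * (n - 1)"
    and "card {(p, q). p \<in> {1..n} \<and> q \<in> {1..n} \<and> p \<noteq> q \<and> w p = q} = n - count lam 1"
    and "card {(p, q). p \<in> {1..n} \<and> q \<in> {1..n} \<and> p \<noteq> q \<and> w p = p \<and> w q = q} =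
      count lam 1 * (count lam 1 - 1)"
    and "card {(p, q). p \<in> {1..n} \<and> q \<in> {1..n} \<and> p \<noteq> q \<and> w p = q \<and> w q = p} =
      2 * count lam 2"
proof -
  let ?F = "{i \<in> {1..n}. w i = i}"
  have w: "w i \<in> {1..n}" if "i \<in> {1..n}" for i
    using assms that permutes_in_image[of w "{1..n}" i] by (auto simp: conj_class_def)
  note F = card_fixpoints[OF assms]
  have graph: "card ((\<lambda>p. (p, w p)) ` A) = card A" for A
    by (rule card_image) (auto simp: inj_on_def)
  have "{(p, q). p \<in> {1..n} \<and> q \<in> {1..n} \<and> p \<noteq> q \<and> w p = p} =
      Sigma ?F (\<lambda>p. {1..n} - {p})"
    by auto
  then show "card {(p, q). p \<in> {1..n} \<and> q \<in> {1..n} \<and> p \<noteq> q \<and> w p = p} =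
      count lam 1 * (n - 1)"
    using F by simp
  have "{(p, q). p \<in> {1..n} \<and> q \<in> {1..n} \<and> p \<noteq> q \<and> w p = q} =
      (\<lambda>p. (p, w p)) ` ({1..n} - ?F)"
    using w by auto
  moreover have "card ({1..n} - ?F) = n - count lam 1"
    using F by (subst card_Diff_subset) auto
  ultimately show "card {(p, q). p \<in> {1..n} \<and> q \<in> {1..n} \<and> p \<noteq> q \<and> w p = q} = n - count lam 1"
    by (simp only: graph)
  have "{(p, q). p \<in> {1..n} \<and> q \<in> {1..n} \<and> p \<noteq> q \<and> w p = p \<and> w q = q} =
      Sigma ?F (\<lambda>p. ?F - {p})"
    by auto
  then show "card {(p, q). p \<in> {1..n} \<and> q \<in> {1..n} \<and> p \<noteq> q \<and> w p = p \<and> w q = q} =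
      count lam 1 * (count lam 1 - 1)"
    using F by simp
  let ?T = "{i \<in> {1..n}. w i \<noteq> i \<and> w (w i) = i}"
  \<comment> \<open>An ordered pair swapped by \<open>w\<close> is determined by its first point, so
    each 2-cycle is counted twice.\<close>
  have "p \<in> {1..n} \<and> q \<in> {1..n} \<and> p \<noteq> q \<and> w p = q \<and> w q = p \<longleftrightarrow> p \<in> ?T \<and> q = w p" for p q
    using w[of p] by (cases "q = w p") auto
  then have "{(p, q). p \<in> {1..n} \<and> q \<in> {1..n} \<and> p \<noteq> q \<and> w p = q \<and> w q = p} =
      {(p, q). p \<in> ?T \<and> q = w p}"
    by (simp only:)
  also have "\<dots> = (\<lambda>p. (p, w p)) ` ?T"
    by auto
  finally show "card {(p, q). p \<in> {1..n} \<and> q \<in> {1..n} \<and> p \<noteq> q \<and> w p = q \<and> w q = p} =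
      2 * count lam 2"
    using card_two_cycle_points[OF assms] by (simp only: graph)
qed

text \<open>The pair counts are the same for all members of the class, so the sum in
  \<open>sum_card_equivariant\<close> is \<open>card C\<close> times a constant. The products avoid
  division of natural numbers.\<close>

lemma card_conj_class_incidences:
  fixes lam :: "nat multiset"
  assumes ij: "i \<in> {1..n}" "j \<in> {1..n}" "i \<noteq> j"
  defines "C \<equiv> conj_class n lam"
  shows "n * (n - 1) * card {w \<in> C. w i = i} = card C * (count lam 1 * (n - 1))"
    and "n * (n - 1) * card {w \<in> C. w i = j} = card C * (n - count lam 1)"
    and "n * (n - 1) * card {w \<in> C. w i = i \<and> w j = j} =
      card C * (count lam 1 * (count lam 1 - 1))"
    and "n * (n - 1) * card {w \<in> C. w i = j \<and> w j = i} = card C * (2 * count lam 2)"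
proof -
  have inv: "inv s (s x) = x" "s x = s y \<longleftrightarrow> x = y" if "s permutes {1..n}" for s and x y :: nat
    using permutes_inverses[OF that] permutes_inj[OF that] by (auto simp: inj_eq)
  note sums = sum_card_equivariant[OF _ ij, of _ lam, symmetric, folded C_def]
  note cards = card_offdiagonal_of_conj_class[of _ n lam, folded C_def]
  show "n * (n - 1) * card {w \<in> C. w i = i} = card C * (count lam 1 * (n - 1))"
    \<comment> \<open>The two deleted simplification rules would rewrite the pair sets away from the
      form in which \<open>cards\<close> states them.\<close>
    by (subst sums[of "\<lambda>w p q. w p = p"]) (simp_all add: inv cards del: atLeastAtMost_iff One_nat_def)
  show "n * (n - 1) * card {w \<in> C. w i = j} = card C * (n - count lam 1)"
    by (subst sums[of "\<lambda>w p q. w p = q"]) (simp_all add: inv cards del: atLeastAtMost_iff One_nat_def)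
  show "n * (n - 1) * card {w \<in> C. w i = i \<and> w j = j} =
      card C * (count lam 1 * (count lam 1 - 1))"
    by (subst sums[of "\<lambda>w p q. w p = p \<and> w q = q"])
       (simp_all add: inv cards del: atLeastAtMost_iff One_nat_def)
  show "n * (n - 1) * card {w \<in> C. w i = j \<and> w j = i} = card C * (2 * count lam 2)"
    by (subst sums[of "\<lambda>w p q. w p = q \<and> w q = p"])
       (simp_all add: inv cards del: atLeastAtMost_iff One_nat_def)
qed

section \<open>Block cycles and nonemptiness of conjugacy classes\<close>

text \<open>For \<open>k > 0\<close> this is the \<open>k\<close>-cycle on the block from
  \<open>m + 1\<close> to \<open>m + k\<close>, the identity elsewhere. Such blocks build a
  permutation of given cycle type; \<open>block_cycle 0 n\<close> is also the cyclic shift used for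
  the wrap-around descent.\<close>

definition block_cycle :: "nat \<Rightarrow> nat \<Rightarrow> nat \<Rightarrow> nat" where
  "block_cycle m k x = (if m < x \<and> x < m + k then x + 1 else if x = m + k then m + 1 else x)"

lemma block_cycle_permutes:
  assumes "k > 0"
  shows "block_cycle m k permutes {m + 1..m + k}"
proof (rule bij_imp_permutes)
  show "bij_betw (block_cycle m k) {m + 1..m + k} {m + 1..m + k}"
    by (rule bij_betw_byWitness[where f' = "\<lambda>x. if x = m + 1 then m + k else x - 1"])
       (use assms in \<open>auto simp: block_cycle_def\<close>)
qed (use assms in \<open>auto simp: block_cycle_def\<close>)

lemma orbit_block_cycle:
  assumes "x \<in> {m + 1..m + k}"
  shows "orbit (block_cycle m k) x = {m + 1..m + k}"
proof -
  have k: "k > 0" using assms by auto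
  have pow: "(block_cycle m k ^^ j) (m + 1) = m + 1 + j" if "j < k" for j
    using that by (induction j) (auto simp: block_cycle_def)
  obtain k' where k': "k = Suc k'" using k gr0_conv_Suc by auto
  have "(block_cycle m k ^^ k) (m + 1) = m + 1"
    using pow[of k'] by (simp add: k' block_cycle_def)
  then have "orbit (block_cycle m k) (m + 1) = {(block_cycle m k ^^ j) (m + 1) |j. j < k}"
    using k by (rule orbit_altdef_bounded)
  also have "\<dots> = (\<lambda>j. m + 1 + j) ` {..<k}"
    using pow by (auto simp: image_iff) metis
  also have "\<dots> = {m + 1..m + k}"
  proof (intro equalityI subsetI)
    fix y assume "y \<in> {m + 1..m + k}"
    then show "y \<in> (\<lambda>j. m + 1 + j) ` {..<k}"
      by (intro image_eqI[of _ _ "y - (m + 1)"]) auto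
  qed auto
  finally have "cyclic_on (block_cycle m k) {m + 1..m + k}"
    using k by (intro cyclic_on_singleI[of "m + 1"]) auto
  then show ?thesis using assms by (rule orbit_cyclic_eq3)
qed

text \<open>\<open>block_cycle m k\<close> fixes the points up to \<open>m\<close> and
  \<open>w\<close> fixes those beyond, so the old cycles survive and the new block becomes one
  further cycle.\<close>

lemma cycle_type_block_extend:
  assumes w: "w permutes {1..m}" and "k > 0"
  shows "cycle_type (m + k) (w \<circ> block_cycle m k) = add_mset k (cycle_type m w)"
proof -
  let ?v = "w \<circ> block_cycle m k"
  have perm: "permutation w" using w permutation_permutes by blast
  have old: "orbit ?v i = orbit w i" if "i \<in> {1..m}" for i
  proof (rule orbit_cong)
    fix s assume "s \<in> orbit w i"
    then have "s \<le> m" using permutes_orbit_subset[OF w that] by auto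
    then show "?v s = w s" using \<open>k > 0\<close> by (simp add: block_cycle_def)
  qed (rule permutation_self_in_orbit[OF perm])
  have new: "orbit ?v i = {m + 1..m + k}" if i: "i \<in> {m + 1..m + k}" for i
  proof -
    have "orbit ?v i = orbit (block_cycle m k) i"
    proof (rule orbit_cong)
      fix s assume "s \<in> orbit (block_cycle m k) i"
      then have "block_cycle m k s \<in> {m + 1..m + k}"
        using orbit.step[of s "block_cycle m k" i] orbit_block_cycle[OF i] by simp
      then show "?v s = block_cycle m k s"
        using permutes_not_in[OF w, of "block_cycle m k s"] by simp
    qed (use orbit_block_cycle[OF i] i in simp)
    with orbit_block_cycle[OF i] show ?thesis by simp
  qed
  have "{1..m + k} = {m + 1..m + k} \<union> {1..m}" by auto
  then have "orbit ?v ` {1..m + k} = orbit ?v ` {m + 1..m + k} \<union> orbit ?v ` {1..m}"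
    by (simp only: image_Un)
  also have "orbit ?v ` {1..m} = orbit w ` {1..m}"
    using old by (rule image_cong[OF refl])
  also have "orbit ?v ` {m + 1..m + k} = (\<lambda>_. {m + 1..m + k}) ` {m + 1..m + k}"
    using new by (rule image_cong[OF refl])
  also have "\<dots> = {{m + 1..m + k}}"
    using \<open>k > 0\<close> by (intro image_constant[of "m + 1"]) simp
  finally have eq: "orbit ?v ` {1..m + k} = insert {m + 1..m + k} (orbit w ` {1..m})"
    by (simp only: insert_is_Un[symmetric])
  \<comment> \<open>\<open>cycle_type\<close> is taken over a set of orbits, so the new block adds a
    part only because it is not already an orbit of \<open>w\<close>.\<close>
  have "{m + 1..m + k} \<notin> orbit w ` {1..m}"
  proof
    assume "{m + 1..m + k} \<in> orbit w ` {1..m}"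
    then have "{m + 1..m + k} \<subseteq> {1..m}" using permutes_orbit_subset[OF w] by blast
    then show False using \<open>k > 0\<close> by simp
  qed
  then show ?thesis unfolding cycle_type_def eq by simp
qed

text \<open>One block is appended for each part. Nonemptiness is what makes
  \<open>pmf_of_set\<close> the uniform measure on the class.\<close>

lemma conj_class_nonempty:
  assumes "is_partition lam n"
  shows "conj_class n lam \<noteq> {}"
proof -
  have "\<exists>w. w permutes {1..sum_mset lam} \<and> cycle_type (sum_mset lam) w = lam" if "0 \<notin># lam"
    using that
  proof (induction lam)
    case empty
    then show ?case by (auto simp: cycle_type_def intro: permutes_id)
  next
    case (add k lam)
    then have k: "k > 0" by auto
    let ?m = "sum_mset lam"
    from add obtain w where w: "w permutes {1..?m}" "cycle_type ?m w = lam" by auto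
    have "w \<circ> block_cycle ?m k permutes {1..?m + k}"
      using k by (intro permutes_compose permutes_subset[OF block_cycle_permutes]
          permutes_subset[OF w(1)]) auto
    moreover have "sum_mset (add_mset k lam) = ?m + k" by simp
    ultimately show ?case
      using cycle_type_block_extend[OF w(1) k] w(2) by metis
  qed
  with assms show ?thesis by (auto simp: is_partition_def conj_class_def)
qed

section \<open>Cyclic descents\<close>

text \<open>
  Conjugation by the transposition of \<open>i\<close> and \<open>i + 1\<close> exchanges descents and ascents at \<open>i\<close>,
  except for those \<open>w\<close> that preserve the set \<open>{i, i + 1}\<close>.
\<close>
lemma card_adjacent_descent:
  fixes lam :: "nat multiset"
  assumes i: "1 \<le> i" "i < n"
  defines "C \<equiv> conj_class n lam"
  shows "2 * card {w \<in> C. w (i + 1) < w i} + card {w \<in> C. w i = i \<and> w (i + 1) = i + 1} =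
    card C + card {w \<in> C. w i = i + 1 \<and> w (i + 1) = i}"
proof -
  define s where "s = Transposition.transpose i (i + 1)"
  have s: "s permutes {1..n}" unfolding s_def using i by (intro permutes_swap_id) auto
  have inv: "inv s = s" by (simp add: s_def)
  have fin: "finite C" unfolding C_def by (rule finite_conj_class)
  have ne: "w i \<noteq> w (i + 1)" if "w \<in> C" for w
    using that permutes_inj[of w "{1..n}"] by (auto simp: C_def conj_class_def inj_eq)
  let ?D = "{w \<in> C. w (i + 1) < w i}" and ?U = "{w \<in> C. w i < w (i + 1)}"
  let ?A = "{w \<in> C. w i = i + 1 \<and> w (i + 1) = i}"
  let ?B = "{w \<in> C. w i = i \<and> w (i + 1) = i + 1}"
  let ?P = "\<lambda>w. w i < w (i + 1) \<and> \<not> (w i = i \<and> w (i + 1) = i + 1)"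
  \<comment> \<open>Conjugation exchanges both the positions and the values \<open>i\<close>,
    \<open>i + 1\<close>. Exchanging these adjacent values alters the order of two values only if
    they are exactly \<open>i\<close> and \<open>i + 1\<close>.\<close>
  have flip: "?P (s \<circ> w \<circ> inv s) \<longleftrightarrow> w (i + 1) < w i \<and> \<not> (w i = i + 1 \<and> w (i + 1) = i)" for w
    unfolding inv by (auto simp: s_def Transposition.transpose_def)
  have "card (?D - ?A) = card {w \<in> C. ?P (s \<circ> w \<circ> inv s)}"
    unfolding flip by (rule arg_cong[where f = card]) blast
  also have "\<dots> = card {w \<in> C. ?P w}"
    unfolding C_def by (rule card_conj_class_conj[OF s, of lam ?P])
  also have "\<dots> = card (?U - ?B)"
    by (rule arg_cong[where f = card]) blast
  finally have *: "card (?D - ?A) = card (?U - ?B)" .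
  have subs: "?A \<subseteq> ?D" "?B \<subseteq> ?U" by auto
  have fins: "finite ?D" "finite ?U" using fin by simp_all
  have "card (?D - ?A) = card ?D - card ?A" "card (?U - ?B) = card ?U - card ?B"
    using subs fins by (blast intro: card_Diff_subset finite_subset)+
  \<comment> \<open>These bounds make the truncated differences above exact.\<close>
  moreover have "card ?A \<le> card ?D" "card ?B \<le> card ?U"
    using subs fins by (blast intro: card_mono)+
  moreover have "card C = card ?D + card ?U"
  proof -
    have "C = ?D \<union> ?U" using ne linorder_neqE_nat by blast
    then have "card C = card (?D \<union> ?U)" by (rule arg_cong)
    also have "\<dots> = card ?D + card ?U" using fins by (rule card_Un_disjoint) force
    finally show ?thesis .
  qed
  ultimately show ?thesis using * by linarith
qed

text \<open>
  Conjugation by the cyclic shift moves the pair \<open>(n, 1)\<close> to \<open>(1, 2)\<close>; it only fails to preserve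
  the relative order of two values when one of them is \<open>n\<close>.
\<close>
lemma card_wrap_descent:
  fixes lam :: "nat multiset"
  assumes n: "n \<ge> 2"
  defines "C \<equiv> conj_class n lam"
  shows "card {w \<in> C. w 1 < w n} + card {w \<in> C. w 1 = n} =
    card {w \<in> C. w 2 < w 1} + card {w \<in> C. w n = n}"
proof -
  define s where "s = block_cycle 0 n"
  have s: "s permutes {1..n}" using block_cycle_permutes[of n 0] n by (simp add: s_def)
  have fin: "finite C" unfolding C_def by (rule finite_conj_class)
  have "s n = 1" "s 1 = 2" using n by (auto simp: s_def block_cycle_def)
  then have inv: "inv s 1 = n" "inv s 2 = 1"
    using permutes_inverses(2)[OF s] by metis+
  have range: "w 1 \<in> {1..n}" "w n \<in> {1..n}" "w 1 \<noteq> w n" if "w \<in> C" for w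
  proof -
    have "w permutes {1..n}" using that by (simp add: C_def conj_class_def)
    then show "w 1 \<in> {1..n}" "w n \<in> {1..n}" "w 1 \<noteq> w n"
      using n permutes_in_image[of w "{1..n}"] permutes_inj[of w "{1..n}"]
      by (auto simp: inj_eq)
  qed
  \<comment> \<open>The shift raises every value by one except \<open>n\<close>, which becomes the
    smallest value 1.\<close>
  have less: "s b < s a \<longleftrightarrow> b = n \<or> b < a \<and> a \<noteq> n"
    if "a \<in> {1..n}" "b \<in> {1..n}" "a \<noteq> b" for a b
    using that by (auto simp: s_def block_cycle_def)
  have shifted: "(s \<circ> w \<circ> inv s) 2 < (s \<circ> w \<circ> inv s) 1 \<longleftrightarrow> w 1 = n \<or> w 1 < w n \<and> w n \<noteq> n"
    if "w \<in> C" for w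
    unfolding comp_apply inv
    by (rule less[OF range(2,1)[OF that] range(3)[OF that, symmetric]])
  have "card {w \<in> C. w 2 < w 1} = card {w \<in> C. (s \<circ> w \<circ> inv s) 2 < (s \<circ> w \<circ> inv s) 1}"
    unfolding C_def by (rule card_conj_class_conj[OF s, of lam "\<lambda>w. w 2 < w 1", symmetric])
  also have "\<dots> = card ({w \<in> C. w 1 = n} \<union> {w \<in> C. w 1 < w n \<and> w n \<noteq> n})"
    using shifted by (intro arg_cong[where f = card]) blast
  also have "\<dots> = card {w \<in> C. w 1 = n} + card {w \<in> C. w 1 < w n \<and> w n \<noteq> n}"
    using fin range by (intro card_Un_disjoint) (auto simp: not_less[symmetric])
  finally have shift: "card {w \<in> C. w 2 < w 1} =
      card {w \<in> C. w 1 = n} + card {w \<in> C. w 1 < w n \<and> w n \<noteq> n}" .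
  \<comment> \<open>Fixing \<open>n\<close> forces a wrap-around descent, so the fixing permutations
    are a disjoint summand of the event.\<close>
  have "w 1 < w n" if "w \<in> C" "w n = n" for w
    using range[OF that(1)] that(2) by auto
  then have "{w \<in> C. w 1 < w n} = {w \<in> C. w 1 < w n \<and> w n \<noteq> n} \<union> {w \<in> C. w n = n}"
    by auto
  then have "card {w \<in> C. w 1 < w n} =
      card {w \<in> C. w 1 < w n \<and> w n \<noteq> n} + card {w \<in> C. w n = n}"
    using fin by (simp only:) (intro card_Un_disjoint, auto)
  with shift show ?thesis by simp
qed

section \<open>Summation over positions and the expectation\<close>

lemma sum_cdes_conj_class:
  assumes "n \<ge> 1"
  shows "(\<Sum>w\<in>conj_class n lam. cdes n w) =
    (\<Sum>i\<in>{1..<n}. card {w \<in> conj_class n lam. w (i + 1) < w i}) +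
    card {w \<in> conj_class n lam. w 1 < w n}"
proof -
  let ?R = "\<lambda>w i. (if i = n then w 1 else w (i + 1)) < w i"
  have "(\<Sum>w\<in>conj_class n lam. cdes n w) =
      (\<Sum>w\<in>conj_class n lam. card {i \<in> {1..n}. ?R w i})"
    by (simp add: cdes_def cyclic_descent_set_def)
  \<comment> \<open>Exchange of summation, that is, linearity of expectation; the index
    \<open>n\<close> is then split off as the wrap-around position.\<close>
  also have "\<dots> = (\<Sum>i\<in>{1..n}. card {w \<in> conj_class n lam. ?R w i})"
    by (rule sum_multicount_gen) (auto simp: finite_conj_class)
  also have "{1..n} = insert n {1..<n}" using assms by auto
  finally show ?thesis by simp
qed

lemma class_expectation_cdes:
  assumes n: "n \<ge> 2" and part: "is_partition lam n"
  shows "class_expectation n lam (\<lambda>w. real (cdes n w)) =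
    real n / 2
    + (real (count lam 2) - real (count lam 1 choose 2)) / (real n - 1)
    + (real (count lam 1) - 1) / (real n - 1)"
proof -
  define C where "C = conj_class n lam"
  have fin: "finite C" and ne: "C \<noteq> {}"
    using finite_conj_class conj_class_nonempty[OF part] by (auto simp: C_def)
  define N where "N = real (card C)"
  have N: "N > 0" using fin ne by (simp add: N_def card_gt_0_iff)
  define r where "r = real n"
  have r: "r \<ge> 2" using n by (simp add: r_def)
  define a b where "a = real (count lam 1)" and "b = real (count lam 2)"
  have a_le: "count lam 1 \<le> n"
  proof -
    obtain w where "w \<in> conj_class n lam" using ne by (auto simp: C_def)
    then have "count lam 1 = card {i \<in> {1..n}. w i = i}" by (rule card_fixpoints[symmetric])
    also have "\<dots> \<le> card {1..n}" by (rule card_mono) auto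
    finally show ?thesis by simp
  qed
  \<comment> \<open>Truncation at \<open>k = 0\<close> is harmless, because the other factor
    vanishes.\<close>
  have real_pred: "real (k * (k - 1)) = real k * (real k - 1)" for k :: nat
    by (cases k) (simp_all add: algebra_simps)
  have choose: "real (count lam 1 choose 2) = a * (a - 1) / 2"
  proof -
    have "2 * (count lam 1 choose 2) = count lam 1 * (count lam 1 - 1)"
      unfolding choose_two by (rule dvd_mult_div_cancel) (cases "count lam 1", auto)
    then show ?thesis
      using real_pred[of "count lam 1"] unfolding a_def by linarith
  qed
  have quotient: "real k = real m / (r * (r - 1))" if "n * (n - 1) * k = m" for k m
  proof -
    have "real m = r * (r - 1) * real k"
      unfolding that[symmetric] of_nat_mult[of _ k] real_pred r_def ..
    with r show ?thesis by (simp add: field_simps)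
  qed
  \<comment> \<open>As real numbers, \<open>p\<close> counts the members of \<open>C\<close> that
    swap two given distinct points, and \<open>q\<close> those that fix both.\<close>
  define p q where "p = N * (2 * b) / (r * (r - 1))" and "q = N * (a * (a - 1)) / (r * (r - 1))"
  have adjacent: "real (card {w \<in> C. w (i + 1) < w i}) = (N + p - q) / 2" if "i \<in> {1..<n}" for i
  proof -
    have ij: "i \<in> {1..n}" "i + 1 \<in> {1..n}" "i \<noteq> i + 1" using that by auto
    have "real (card {w \<in> C. w i = i + 1 \<and> w (i + 1) = i}) = p"
      unfolding p_def C_def N_def b_def
      by (subst quotient[OF card_conj_class_incidences(4)[OF ij]]) simp
    moreover have "real (card {w \<in> C. w i = i \<and> w (i + 1) = i + 1}) = q"
      unfolding q_def C_def N_def a_def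
      by (subst quotient[OF card_conj_class_incidences(3)[OF ij]]) (simp only: of_nat_mult[of "card _"] real_pred)
    moreover have "2 * card {w \<in> C. w (i + 1) < w i} + card {w \<in> C. w i = i \<and> w (i + 1) = i + 1} =
        card C + card {w \<in> C. w i = i + 1 \<and> w (i + 1) = i}"
      unfolding C_def using that by (intro card_adjacent_descent) auto
    moreover have "real d = (real c + p - q) / 2"
      if "real x = p" "real y = q" "2 * d + y = c + x" for c d x y
      using that(1,2) arg_cong[where f = real, OF that(3)] by simp
    ultimately show ?thesis unfolding N_def by blast
  qed
  \<comment> \<open>Both orders of the pair are needed: the event \<open>w n = n\<close> takes
    \<open>n\<close> as first point, the event \<open>w 1 = n\<close> takes 1.\<close>
  have n1: "n \<in> {1..n}" "1 \<in> {1..n}" "n \<noteq> 1" and 1: "1 \<in> {1..n}" "n \<in> {1..n}" "1 \<noteq> n"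
    using n by auto
  have "real (card {w \<in> C. w n = n}) = N * (a * (r - 1)) / (r * (r - 1))"
    unfolding C_def N_def a_def r_def
    by (subst quotient[OF card_conj_class_incidences(1)[OF n1]]) (use n in \<open>simp add: r_def\<close>)
  moreover have "real (card {w \<in> C. w 1 = n}) = N * (r - a) / (r * (r - 1))"
    unfolding C_def N_def a_def r_def
    by (subst quotient[OF card_conj_class_incidences(2)[OF 1]]) (use a_le in \<open>simp add: r_def\<close>)
  moreover have "real (card {w \<in> C. w 2 < w 1}) = (N + p - q) / 2"
    using adjacent[of 1] n by (simp add: numeral_2_eq_2)
  ultimately have wrap: "real (card {w \<in> C. w 1 < w n}) =
      (N + p - q) / 2 + N * (a * (r - 1)) / (r * (r - 1)) - N * (r - a) / (r * (r - 1))"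
    using card_wrap_descent[OF n, of lam, folded C_def, THEN arg_cong[where f = real]]
    unfolding of_nat_add by argo
  have "(\<Sum>w\<in>C. real (cdes n w)) =
      real ((\<Sum>i\<in>{1..<n}. card {w \<in> C. w (i + 1) < w i}) + card {w \<in> C. w 1 < w n})"
    using sum_cdes_conj_class[of n lam, folded C_def] n by (simp flip: of_nat_sum)
  also have "\<dots> = (r - 1) * ((N + p - q) / 2) + real (card {w \<in> C. w 1 < w n})"
  proof -
    have "(\<Sum>i\<in>{1..<n}. real (card {w \<in> C. w (i + 1) < w i})) = (\<Sum>i\<in>{1..<n}. (N + p - q) / 2)"
      using adjacent by (rule sum.cong[OF refl])
    with n show ?thesis by (simp add: r_def)
  qed
  finally have total: "(\<Sum>w\<in>C. real (cdes n w)) = (r - 1) * ((N + p - q) / 2) +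
      ((N + p - q) / 2 + N * (a * (r - 1)) / (r * (r - 1)) - N * (r - a) / (r * (r - 1)))"
    unfolding wrap .
  have "class_expectation n lam (\<lambda>w. real (cdes n w)) = (\<Sum>w\<in>C. real (cdes n w)) / N"
    unfolding class_expectation_def C_def[symmetric] N_def by (rule integral_pmf_of_set[OF ne fin])
  also have "\<dots> = r / 2 + (b - a * (a - 1) / 2) / (r - 1) + (a - 1) / (r - 1)"
  proof -
    \<comment> \<open>The numerators combine by \<open>a * (r - 1) - (r - a) = r * (a - 1)\<close>,
      after which \<open>r\<close> cancels.\<close>
    have "N * (a * (r - 1)) / (r * (r - 1)) - N * (r - a) / (r * (r - 1)) =
        r * (N * (a - 1)) / (r * (r - 1))"
      unfolding diff_divide_distrib[symmetric] by (simp add: algebra_simps)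
    then have fixed: "N * (a * (r - 1)) / (r * (r - 1)) - N * (r - a) / (r * (r - 1)) =
        N * ((a - 1) / (r - 1))"
      using r by simp
    define x where "x = (b - a * (a - 1) / 2) / (r - 1)"
    have "r * p = N * (2 * b) / (r - 1)" "r * q = N * (a * (a - 1)) / (r - 1)"
      using r by (simp_all add: p_def q_def)
    then have "r * p - r * q = N * (2 * x)"
      using r by (simp add: x_def field_simps)
    \<comment> \<open>All \<open>n\<close> positions contribute \<open>(N + p - q) / 2\<close>, the
      wrap-around one included; its correction is the last summand.\<close>
    moreover have "(\<Sum>w\<in>C. real (cdes n w)) = (r * N + (r * p - r * q)) / 2 + N * ((a - 1) / (r - 1))"
      unfolding total fixed[symmetric] by (simp add: algebra_simps add_divide_distrib diff_divide_distrib)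
    ultimately have "(\<Sum>w\<in>C. real (cdes n w)) = N * (r / 2 + x + (a - 1) / (r - 1))"
      by (simp add: distrib_left add_divide_distrib mult.commute)
    with N show ?thesis by (simp add: x_def)
  qed
  finally show ?thesis by (simp only: choose a_def b_def r_def)
qed

theorem theorem4p14:
  fixes n :: nat
  assumes "n \<ge> 2"
  shows "(\<forall>lam. is_partition lam n \<longrightarrow>
            class_expectation n lam (\<lambda>w. real (cdes n w)) =
              real n / 2
              + (real (count lam 2) - real (count lam 1 choose 2)) / (real n - 1)
              + (real (count lam 1) - 1) / (real n - 1))
       \<and> (\<forall>lam mu. is_partition lam n \<and> count lam 1 = 0 \<and> count lam 2 = 0 \<and>
                   is_partition mu n \<and> count mu 1 = 0 \<and> count mu 2 = 0 \<longrightarrow>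
            class_expectation n lam (\<lambda>w. real (cdes n w)) =
            class_expectation n mu (\<lambda>w. real (cdes n w)))"
  using class_expectation_cdes[OF assms] by simp

end
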